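(* For every linear ordering $\mathcal{X} = (X, \leq)$, every graph on $X$ is an $\mathcal{X}$-rainbow threshold graph; that is, for every graph $\mathcal{G}$ with vertex set $X$ there are a set $K$ and a $K$-rainbow sequence $S$ on $X$ such that $\mathcal{G} = \mathcal{G}_{S,\leq}$.
   Context: Graphs are simple undirected graphs, and $\mathcal{P}(K)$ is the power set of $K$. For sets $K, X$ (possibly infinite), a $K$-rainbow sequence on $X$ is a pair $S=(a,e)$ of functions $a:X\to K$ and $e:X\to\mathcal{P}(K)$. Given a linear ordering $\mathcal{X}=(X,\leq)$ and a $K$-rainbow sequence $S=(a,e)$ on $X$, $\mathcal{G}_{S,\leq}$ is the graph on vertex set $X$ in which, for all $x<y$ in $X$, $x$ and $y$ are adjacent if and only if $a(x)\in e(y)$; it is called the $\mathcal{X}$-rainbow threshold graph associated with $S$ and $\mathcal{X}$. *)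

theory Defs
  imports "HOL-Library.FuncSet" "Graph_Theory.Pair_Digraph"
begin

text \<open>
  A simple undirected graph, possibly infinite, is a \<^locale>\<open>pair_bidirected_digraph\<close>: a symmetric
  loop-free relation on its vertex set (\<^locale>\<open>pair_graph\<close> would additionally require finiteness).
  An undirected edge joining x and y is the pair of opposite arcs (x, y) and (y, x).
\<close>

text \<open>Sequences are HOL functions; only their values on X matter.\<close>

definition rainbow_sequence ::
  "'k set \<Rightarrow> 'a set \<Rightarrow> ('a \<Rightarrow> 'k) \<times> ('a \<Rightarrow> 'k set) \<Rightarrow> bool" where
  "rainbow_sequence K X S \<longleftrightarrow> (case S of (a, e) \<Rightarrow> a \<in> X \<rightarrow> K \<and> e \<in> X \<rightarrow> Pow K)"

text \<open>The relation r is the reflexive order on X. The two disjuncts are the two ways in which an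
  unordered pair of distinct vertices can be listed with the smaller one first.\<close>

definition rainbow_threshold_graph ::
  "'a set \<Rightarrow> 'a rel \<Rightarrow> ('a \<Rightarrow> 'k) \<times> ('a \<Rightarrow> 'k set) \<Rightarrow> 'a pair_pre_digraph" where
  "rainbow_threshold_graph X r S = (case S of (a, e) \<Rightarrow>
     \<lparr> pverts = X,
       parcs = {(x, y). x \<in> X \<and> y \<in> X \<and> x \<noteq> y \<and>
                  ((x, y) \<in> r \<and> a x \<in> e y \<or> (y, x) \<in> r \<and> a y \<in> e x)} \<rparr>)"

lemma pverts_rainbow_threshold_graph [simp]: "pverts (rainbow_threshold_graph X r S) = X"
  by (simp add: rainbow_threshold_graph_def split: prod.split)

lemma rainbow_threshold_graph_adjacent_iff:
  assumes "linear_order_on X r" and "(x, y) \<in> r" and "x \<noteq> y"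
  shows "(x, y) \<in> parcs (rainbow_threshold_graph X r (a, e)) \<longleftrightarrow> a x \<in> e y"
    and "(y, x) \<in> parcs (rainbow_threshold_graph X r (a, e)) \<longleftrightarrow> a x \<in> e y"
  using assms by (auto simp: rainbow_threshold_graph_def order_on_defs dest: antisymD)

lemma pair_bidirected_digraph_rainbow_threshold_graph:
  "pair_bidirected_digraph (rainbow_threshold_graph X r S)"
proof -
  have "sym (parcs (rainbow_threshold_graph X r S))"
    by (auto simp: rainbow_threshold_graph_def sym_def split: prod.split)
  then show ?thesis
    by unfold_locales
      (auto simp: symmetric_def arcs_ends_def arc_to_ends_def rainbow_threshold_graph_def
        split: prod.splits)
qed

end

theory Submission
  imports Defs
begin

text \<open>Give each vertex its own colour, itself, and let \<open>e y\<close> be the neighbourhood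
  of \<open>y\<close>. Then \<open>a x \<in> e y\<close> just says that \<open>x\<close> and
  \<open>y\<close> are adjacent. As adjacency is symmetric, the order only decides which endpoint is
  tested, and any linear order works.\<close>

theorem proposition2p7:
  fixes X :: "'a set" and r :: "'a rel" and G :: "'a pair_pre_digraph"
  assumes "linear_order_on X r"
    and "pair_bidirected_digraph G" and "pverts G = X"
  shows "\<exists>(K :: 'a set) S. rainbow_sequence K X S \<and> G = rainbow_threshold_graph X r S"
proof (intro exI conjI)
  interpret pair_bidirected_digraph G by fact
  let ?S = "(\<lambda>x. x, \<lambda>y. {x \<in> X. (x, y) \<in> parcs G})"
  show "rainbow_sequence X X ?S"
    by (auto simp: rainbow_sequence_def)
  have sym: "(x, y) \<in> parcs G \<longleftrightarrow> (y, x) \<in> parcs G" for x y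
    by (blast intro: arcs_symmetric)
  have wf: "x \<in> X \<and> y \<in> X \<and> x \<noteq> y" if "(x, y) \<in> parcs G" for x y
    using that in_arcsD1 in_arcsD2 no_loops'[of x] assms(3) by blast
  have total: "(x, y) \<in> r \<or> (y, x) \<in> r" if "x \<in> X" "y \<in> X" "x \<noteq> y" for x y
    using that assms(1) by (auto simp: order_on_defs total_on_def)
  \<comment> \<open>From left to right, \<open>total\<close> picks a disjunct, and
    \<open>sym\<close> reverses the arc if \<open>y\<close> is the smaller endpoint; conversely,
    \<open>sym\<close> turns the second disjunct into the arc wanted.\<close>
  have "parcs G = parcs (rainbow_threshold_graph X r ?S)"
    using wf total sym by (auto simp: rainbow_threshold_graph_def)
  with assms(3) show "G = rainbow_threshold_graph X r ?S"
    by (intro pair_pre_digraph.equality) auto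
qed

end
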